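(* Let $E$ be a $T$-universally complete Riesz space with weak order unit $e$, where $T$ is a strictly positive conditional expectation operator on $E$ with $Te=e$, and let $S$ be a conditional expectation operator on $E$ with $TS=T=ST$. If $f\in\mathcal{L}^2(T)$ then $Sf\in\mathcal{L}^2(T)$.
   Context: A conditional expectation operator on a Dedekind complete Riesz space $E$ with weak order unit is a positive order continuous projection $T:E\to E$ whose range $\mathcal{R}(T)$ is a Dedekind complete Riesz subspace of $E$ and such that $Te$ is a weak order unit of $E$ for each weak order unit $e$ of $E$. $T$ is strictly positive if $f\ge 0$ and $Tf=0$ imply $f=0$. Given a strictly positive conditional expectation operator $T$ on a Dedekind complete Riesz space $E$ with weak order unit, $E$ is called $T$-universally complete if each increasing net $(f_\alpha)$ in $E_+$ for which $(Tf_\alpha)$ is order bounded in the universal completion $E^u$ of $E$ is order convergent in $E$. (A $T$-universally complete space is in particular Dedekind complete.) The universal completion $E^u$ carries its natural $f$-algebra multiplication with multiplicative unit $e$, determined by $(Pe)\cdot(Qe)=PQe$ for band projections $P,Q$. All products and powers are taken in $E^u$. For $E$ $T$-universally complete, $\mathcal{L}^1(T)=E$ and $\mathcal{L}^2(T):=\{x\in\mathcal{L}^1(T) : x^2\in\mathcal{L}^1(T)\}$. *)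

theory Defs
  imports Complex_Main "HOL-Library.Lattice_Algebras"
begin

section \<open>Riesz spaces\<close>

class riesz_space = ordered_real_vector + lattice_ab_group_add_abs

class dedekind_complete_riesz_space = riesz_space + conditionally_complete_lattice

text \<open>Universally complete: Dedekind complete and laterally complete.\<close>

class universally_complete_riesz_space = dedekind_complete_riesz_space +
  assumes laterally_complete:
    "D \<noteq> {} \<Longrightarrow> (\<And>x. x \<in> D \<Longrightarrow> 0 \<le> x) \<Longrightarrow>
      (\<And>x y. x \<in> D \<Longrightarrow> y \<in> D \<Longrightarrow> x \<noteq> y \<Longrightarrow> inf x y = 0) \<Longrightarrow>
      \<exists>s. (\<forall>x\<in>D. x \<le> s) \<and> (\<forall>u. (\<forall>x\<in>D. x \<le> u) \<longrightarrow> s \<le> u)"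

text \<open>Associativity, bilinearity and positivity of products come from
  \<^class>\<open>real_algebra\<close> and \<^class>\<open>lattice_ring\<close>. No unit is built in, since
  the unit of the multiplication depends on the chosen weak order unit.\<close>

class f_algebra = riesz_space + real_algebra + lattice_ring +
  assumes f_algebra_left: "inf x y = 0 \<Longrightarrow> 0 \<le> z \<Longrightarrow> inf (z * x) y = 0"
    and f_algebra_right: "inf x y = 0 \<Longrightarrow> 0 \<le> z \<Longrightarrow> inf (x * z) y = 0"

definition riesz_subspace :: "'a::riesz_space set \<Rightarrow> bool" where
  "riesz_subspace R \<longleftrightarrow> subspace R \<and> (\<forall>x\<in>R. \<forall>y\<in>R. sup x y \<in> R \<and> inf x y \<in> R)"

text \<open>Completeness of \<open>R\<close> in its own right: bounds and suprema are formed inside \<open>R\<close>.\<close>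

definition dedekind_complete_subspace :: "'a::riesz_space set \<Rightarrow> bool" where
  "dedekind_complete_subspace R \<longleftrightarrow> riesz_subspace R \<and>
    (\<forall>D. D \<subseteq> R \<and> D \<noteq> {} \<and> (\<exists>u\<in>R. \<forall>x\<in>D. x \<le> u) \<longrightarrow>
      (\<exists>s\<in>R. (\<forall>x\<in>D. x \<le> s) \<and> (\<forall>u\<in>R. (\<forall>x\<in>D. x \<le> u) \<longrightarrow> s \<le> u)))"

definition order_ideal :: "'a::riesz_space set \<Rightarrow> bool" where
  "order_ideal A \<longleftrightarrow> subspace A \<and> (\<forall>x\<in>A. \<forall>y. \<bar>y\<bar> \<le> \<bar>x\<bar> \<longrightarrow> y \<in> A)"

definition band :: "'a::dedekind_complete_riesz_space set \<Rightarrow> bool" where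
  "band B \<longleftrightarrow> order_ideal B \<and> (\<forall>D. D \<subseteq> B \<and> D \<noteq> {} \<and> bdd_above D \<longrightarrow> Sup D \<in> B)"

definition disjoint_complement :: "'a::riesz_space set \<Rightarrow> 'a set" where
  "disjoint_complement A = {x. \<forall>y\<in>A. inf \<bar>x\<bar> \<bar>y\<bar> = 0}"

definition band_projection :: "('a::dedekind_complete_riesz_space \<Rightarrow> 'a) \<Rightarrow> bool" where
  "band_projection P \<longleftrightarrow>
    (\<exists>B. band B \<and> (\<forall>x. P x \<in> B \<and> x - P x \<in> disjoint_complement B))"

text \<open>The band generated by \<open>e\<close> is the whole space.\<close>

definition weak_order_unit :: "'a::dedekind_complete_riesz_space \<Rightarrow> bool" where
  "weak_order_unit e \<longleftrightarrow> 0 \<le> e \<and> (\<Inter>{B. band B \<and> e \<in> B}) = UNIV"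


section \<open>Order convergence\<close>

definition decreases_to_zero :: "'a::dedekind_complete_riesz_space set \<Rightarrow> bool" where
  "decreases_to_zero D \<longleftrightarrow> D \<noteq> {} \<and> (\<forall>x\<in>D. \<forall>y\<in>D. \<exists>z\<in>D. z \<le> x \<and> z \<le> y) \<and>
    bdd_below D \<and> Inf D = 0"

text \<open>Nets are represented by filters: a net \<open>x\<close> over a directed set corresponds to \<open>x\<close>
  together with the filter of tails of that set.\<close>

definition order_converges ::
    "('i \<Rightarrow> 'a::dedekind_complete_riesz_space) \<Rightarrow> 'a \<Rightarrow> 'i filter \<Rightarrow> bool" where
  "order_converges x l F \<longleftrightarrow>
    (\<exists>D. decreases_to_zero D \<and> (\<forall>d\<in>D. eventually (\<lambda>i. \<bar>x i - l\<bar> \<le> d) F))"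

text \<open>Order convergence depends only on the image filter in the space, so filters on the
  space itself account for nets over arbitrary index sets.\<close>

definition order_continuous ::
    "('a::dedekind_complete_riesz_space \<Rightarrow> 'b::dedekind_complete_riesz_space) \<Rightarrow> bool" where
  "order_continuous T \<longleftrightarrow>
    (\<forall>F l. order_converges (\<lambda>x. x) l F \<longrightarrow> order_converges T (T l) F)"

text \<open>An increasing net has the same order limits as its range, an upward directed set
  regarded as a net indexed by itself.\<close>

definition upward_directed :: "'a::order set \<Rightarrow> bool" where
  "upward_directed D \<longleftrightarrow> D \<noteq> {} \<and> (\<forall>x\<in>D. \<forall>y\<in>D. \<exists>z\<in>D. x \<le> z \<and> y \<le> z)"

definition tail_filter :: "'a::order set \<Rightarrow> 'a filter" where
  "tail_filter D = (INF d\<in>D. principal {x\<in>D. d \<le> x})"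


section \<open>Conditional expectation operators\<close>

definition conditional_expectation ::
    "('a::dedekind_complete_riesz_space \<Rightarrow> 'a) \<Rightarrow> bool" where
  "conditional_expectation T \<longleftrightarrow>
    linear T \<and> (\<forall>x. 0 \<le> x \<longrightarrow> 0 \<le> T x) \<and> order_continuous T \<and> (\<forall>x. T (T x) = T x) \<and>
    dedekind_complete_subspace (range T) \<and>
    (\<forall>e. weak_order_unit e \<longrightarrow> weak_order_unit (T e))"

definition strictly_positive :: "('a::riesz_space \<Rightarrow> 'a) \<Rightarrow> bool" where
  "strictly_positive T \<longleftrightarrow> (\<forall>f. 0 \<le> f \<and> T f = 0 \<longrightarrow> f = 0)"


section \<open>Universal completion\<close>

text \<open>\<open>J\<close> is a Riesz isomorphism of the Dedekind complete space onto an order dense Riesz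
  subspace of a universally complete one. This determines the target up to Riesz isomorphism.\<close>

definition universal_completion ::
    "('a::dedekind_complete_riesz_space \<Rightarrow> 'u::universally_complete_riesz_space) \<Rightarrow> bool" where
  "universal_completion J \<longleftrightarrow> linear J \<and> inj J \<and>
    (\<forall>x y. J (sup x y) = sup (J x) (J y)) \<and> (\<forall>x y. J (inf x y) = inf (J x) (J y)) \<and>
    (\<forall>u. 0 < u \<longrightarrow> (\<exists>x. 0 < J x \<and> J x \<le> u))"

text \<open>An \<open>f\<close>-algebra multiplication on the universal completion is determined by its unit \<open>u\<close>.\<close>

definition natural_multiplication ::
    "'u::{universally_complete_riesz_space, f_algebra} \<Rightarrow> bool" where
  "natural_multiplication u \<longleftrightarrow> (\<forall>x. u * x = x \<and> x * u = x) \<and>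
    (\<forall>P Q. band_projection P \<and> band_projection Q \<longrightarrow> P u * Q u = P (Q u))"

definition T_universally_complete ::
    "('a::dedekind_complete_riesz_space \<Rightarrow> 'u::universally_complete_riesz_space) \<Rightarrow>
      ('a \<Rightarrow> 'a) \<Rightarrow> bool" where
  "T_universally_complete J T \<longleftrightarrow>
    (\<forall>D. upward_directed D \<and> (\<forall>x\<in>D. 0 \<le> x) \<and> (\<exists>a b. \<forall>x\<in>D. a \<le> J (T x) \<and> J (T x) \<le> b) \<longrightarrow>
      (\<exists>l. order_converges (\<lambda>x. x) l (tail_filter D)))"

text \<open>For a \<open>T\<close>-universally complete space, \<open>L\<^sup>1(T)\<close> is the space itself,
  which sits in its universal completion as \<open>range J\<close>.\<close>

definition L2_space ::
    "('a::dedekind_complete_riesz_space \<Rightarrow> 'u::{universally_complete_riesz_space, f_algebra}) \<Rightarrow>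
      'a set" where
  "L2_space J = {x. J x * J x \<in> range J}"

end

theory Submission
  imports Defs
begin

text \<open>
  The theorem is a conditional Jensen inequality combined with an ideal property.

  Write \<open>u = J e\<close>. For real \<open>c\<close> the square \<open>(f - c u)\<^sup>2\<close> is positive in \<open>E\<^sup>u\<close>, so
  \<open>2 c f - c\<^sup>2 e \<le> g\<close> in \<open>E\<close>, where \<open>J g = f\<^sup>2\<close>. The operator \<open>S\<close> is linear and positive, and it
  fixes \<open>e\<close> because \<open>S e = S (T e) = T e = e\<close>. Hence \<open>2 c (S f) - c\<^sup>2 e \<le> S g\<close> for every real \<open>c\<close>,
  that is, \<open>(S f)\<^sup>2 - S g \<le> (S f - c u)\<^sup>2\<close> in \<open>E\<^sup>u\<close>.

  Over the real numbers one would now put \<open>c = S f\<close>. Here the same conclusion \<open>(S f)\<^sup>2 \<le> S g\<close>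
  holds because the infimum over all real \<open>c\<close> of \<open>(y - c u)\<^sup>2\<close> is zero
  (\<open>lower_bound_of_squares_nonpos\<close>): viewed as a function, \<open>y\<close> is everywhere close to some point
  of a real grid. Finally \<open>E\<close> is Dedekind complete and order dense in \<open>E\<^sup>u\<close>, hence an ideal of
  \<open>E\<^sup>u\<close> (\<open>universal_completion_ideal\<close>), so \<open>0 \<le> (S f)\<^sup>2 \<le> S g\<close> puts \<open>(S f)\<^sup>2\<close> into \<open>E\<close>.
\<close>

section \<open>The Archimedean property\<close>

text \<open>The supremum \<open>s\<close> of the natural multiples of \<open>x\<close> lies above \<open>(n + 1) x\<close> for every \<open>n\<close>,
  so \<open>s - x\<close> is an upper bound of these multiples as well, and \<open>s \<le> s - x\<close>.\<close>

lemma archimedean_riesz: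
  fixes x y :: "'a::dedekind_complete_riesz_space"
  assumes "\<And>n::nat. real n *\<^sub>R x \<le> y"
  shows "x \<le> 0"
proof -
  define s where "s = Sup (range (\<lambda>n::nat. real n *\<^sub>R x))"
  have bdd: "bdd_above (range (\<lambda>n::nat. real n *\<^sub>R x))"
    using assms by (auto intro!: bdd_aboveI)
  have "real n *\<^sub>R x \<le> s - x" for n :: nat
  proof -
    have "real (Suc n) *\<^sub>R x \<le> s"
      unfolding s_def by (rule cSup_upper[OF _ bdd]) blast
    then show ?thesis by (simp add: algebra_simps)
  qed
  then have "s \<le> s - x"
    by (subst s_def) (rule cSup_least, auto)
  then show ?thesis by simp
qed

section \<open>A Dedekind complete space is an ideal of its universal completion\<close>

lemma universal_completion_le_iff:
  assumes "universal_completion J"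
  shows "J x \<le> J y \<longleftrightarrow> x \<le> y"
  using assms unfolding universal_completion_def
  by (metis inf.absorb_iff1 injD)

text \<open>
  The embedded copy of \<open>E\<close> is an ideal of its universal completion: for \<open>0 \<le> v \<le> J x\<close>, the
  supremum \<open>s\<close> in \<open>E\<close> of the elements below \<open>v\<close> satisfies \<open>J s = v\<close>, since by order density any
  gap between \<open>J s\<close> and \<open>v\<close> would contain some \<open>J z > 0\<close> by which \<open>s\<close> could be improved.
\<close>

lemma universal_completion_ideal:
  fixes J :: "'a::dedekind_complete_riesz_space \<Rightarrow> 'u::universally_complete_riesz_space"
  assumes J: "universal_completion J" and v: "0 \<le> v" "v \<le> J x"
  shows "v \<in> range J"
proof -
  have lin: "linear J" and dense: "\<And>w. 0 < w \<Longrightarrow> \<exists>x. 0 < J x \<and> J x \<le> w"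
    using J by (auto simp: universal_completion_def)
  note le = universal_completion_le_iff[OF J]
  have J0: "J 0 = 0" using lin by (rule linear_0)
  define D where "D = {y. J y \<le> v}"
  define s where "s = Sup D"
  have bdd: "bdd_above D"
    using v(2) le by (intro bdd_aboveI[of _ x]) (auto simp: D_def intro: order_trans)
  have ne: "D \<noteq> {}" using v(1) J0 by (auto simp: D_def intro: exI[of _ 0])
  have upper: "y \<le> s" if "y \<in> D" for y
    unfolding s_def using that bdd by (rule cSup_upper)
  have no_gap: False if z: "0 < J z" and step: "\<And>y. y \<in> D \<Longrightarrow> y \<le> s - z" for z
  proof -
    have "s \<le> s - z" by (subst s_def) (rule cSup_least[OF ne step])
    then have "J z \<le> J 0" unfolding le by simp
    then show False using z J0 by simp
  qed
  let ?m = "inf v (J s)"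
  have below_m: "J y \<le> ?m" if "y \<in> D" for y
    using that upper[OF that] le by (auto simp: D_def)
  have "?m = v"
  proof (rule ccontr)
    assume "?m \<noteq> v"
    then have "?m < v" using inf_le1[of v "J s"] by (rule order.not_eq_order_implies_strict)
    then have "0 < v - ?m" by (simp only: diff_gt_0_iff_gt)
    then obtain z where z: "0 < J z" "J z \<le> v - ?m" using dense by blast
    have "y \<le> s - z" if "y \<in> D" for y
    proof -
      have "J (y + z) \<le> ?m + (v - ?m)"
        unfolding linear_add[OF lin] by (rule add_mono[OF below_m[OF that] z(2)])
      also have "?m + (v - ?m) = v" by (simp only: add.commute[of ?m] diff_add_cancel)
      finally have "y + z \<in> D" by (simp add: D_def)
      then show ?thesis using upper by (simp add: le_diff_eq)
    qed
    then show False using no_gap z by blast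
  qed
  moreover have "?m = J s"
  proof (rule ccontr)
    assume "?m \<noteq> J s"
    then have "?m < J s" using inf_le2[of v "J s"] by (rule order.not_eq_order_implies_strict)
    then have "0 < J s - ?m" by (simp only: diff_gt_0_iff_gt)
    then obtain z where z: "0 < J z" "J z \<le> J s - ?m" using dense by blast
    have "y \<le> s - z" if "y \<in> D" for y
    proof -
      have "J (y + z) \<le> ?m + (J s - ?m)"
        unfolding linear_add[OF lin] by (rule add_mono[OF below_m[OF that] z(2)])
      also have "?m + (J s - ?m) = J s" by (simp only: add.commute[of ?m] diff_add_cancel)
      finally show ?thesis using le by (simp add: le_diff_eq)
    qed
    then show False using no_gap z by blast
  qed
  ultimately show ?thesis by auto
qed

section \<open>Disjointness and squares\<close>

lemma inf_add_le:
  fixes t a b :: "'a::lattice_ab_group_add"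
  assumes "0 \<le> t" "0 \<le> a" "0 \<le> b"
  shows "inf t (a + b) \<le> inf t a + inf t b"
proof -
  have "inf t (a + b) \<le> t + inf t b"
    using assms by (intro order_trans[OF inf_le1]) simp
  moreover have "inf t (a + b) \<le> a + inf t b"
    unfolding add_inf_distrib_left
    using assms by (auto intro: le_infI1 add_increasing)
  ultimately show ?thesis
    unfolding add_inf_distrib_right[of t a] by (rule inf_greatest)
qed

lemma inf_eq_0_mono:
  fixes a :: "'a::lattice_ab_group_add"
  assumes "inf a b = 0" "0 \<le> a'" "a' \<le> a" "0 \<le> b'" "b' \<le> b"
  shows "inf a' b' = 0"
  using assms inf_mono[of a' a b' b] by (intro antisym) auto

lemma inf_pprt_uminus:
  fixes x :: "'a::lattice_ab_group_add"
  shows "inf (pprt x) (pprt (- x)) = 0"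
proof -
  have "pprt x = x + pprt (- x)"
    by (simp add: pprt_def add_sup_distrib_left sup_commute)
  then have "inf (pprt x) (pprt (- x)) = inf (x + pprt (- x)) (0 + pprt (- x))" by simp
  also have "\<dots> = inf x 0 + pprt (- x)" by (simp only: add_inf_distrib_right)
  also have "\<dots> = 0" unfolding pprt_neg nprt_def by (rule right_minus)
  finally show ?thesis .
qed

text \<open>Subtracting \<open>w = inf a b\<close> leaves \<open>a - w\<close> and \<open>b - w\<close>, which are disjoint, so at most
  \<open>pprt w\<close> is common to \<open>pprt w + (a - w)\<close> and \<open>pprt w + (b - w)\<close>.\<close>

lemma pprt_inf:
  fixes a b :: "'a::lattice_ab_group_add"
  shows "pprt (inf a b) = inf (pprt a) (pprt b)"
proof (rule antisym)
  show "pprt (inf a b) \<le> inf (pprt a) (pprt b)" by simp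
  define w where "w = inf a b"
  have shift: "pprt x \<le> pprt w + (x - w)" if "w \<le> x" for x
    using that by (simp add: pprt_def add_sup_distrib_right le_supI2 le_supI1)
  have "inf (pprt a) (pprt b) \<le> inf (pprt w + (a - w)) (pprt w + (b - w))"
    by (intro inf_mono shift) (simp_all add: w_def)
  also have "\<dots> = pprt w + (inf a b - w)"
    by (simp only: add_inf_distrib_left add_inf_distrib_right diff_conv_add_uminus)
  finally show "inf (pprt a) (pprt b) \<le> pprt (inf a b)" by (simp add: w_def)
qed

lemma disjoint_mult_eq_0:
  fixes x y :: "'a::f_algebra"
  assumes "inf x y = 0"
  shows "x * y = 0"
proof -
  have "0 \<le> x" "0 \<le> y" using assms by (metis inf_le1, metis inf_le2)
  then have "inf (x * y) y = 0" using assms by (intro f_algebra_right)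
  then have "inf (x * y) (x * y) = 0"
    using \<open>0 \<le> x\<close> f_algebra_left[of y "x * y" x] by (simp add: inf_commute)
  then show ?thesis by simp
qed

text \<open>The positive part \<open>p\<close> and the negative part \<open>n\<close> of \<open>a\<close> are disjoint and therefore
  annihilate each other, so \<open>(p + n)\<^sup>2\<close> and \<open>(p - n)\<^sup>2\<close> are both \<open>p\<^sup>2 + n\<^sup>2\<close>.\<close>

lemma abs_mult_abs_self:
  fixes a :: "'a::f_algebra"
  shows "\<bar>a\<bar> * \<bar>a\<bar> = a * a"
proof -
  define p n where "p = pprt a" and "n = pprt (- a)"
  have "inf p n = 0" unfolding p_def n_def by (rule inf_pprt_uminus)
  then have "p * n = 0" "n * p = 0"
    by (auto intro: disjoint_mult_eq_0 simp: inf_commute)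
  moreover have "a = p - n" "\<bar>a\<bar> = p + n"
    unfolding p_def n_def by (simp_all add: pprt_neg abs_prts flip: prts)
  ultimately show ?thesis
    by (simp only: distrib_left distrib_right left_diff_distrib right_diff_distrib) simp
qed

lemma f_algebra_square_nonneg:
  fixes a :: "'a::f_algebra"
  shows "0 \<le> a * a"
  by (metis abs_mult_abs_self abs_ge_zero mult_nonneg_nonneg)

section \<open>Squares of real translates have infimum zero\<close>

text \<open>
  The argument takes place in an \<open>f\<close>-algebra with unit \<open>u\<close>. An element \<open>y\<close> may be
  pictured as a function and \<open>u\<close> as the constant one. Then \<open>pprt (y - a *\<^sub>R u)\<close> has support
  \<open>{y > a}\<close>, and \<open>pprt (b *\<^sub>R u - y)\<close> has support \<open>{y < b}\<close>.
\<close>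

context
  fixes u :: "'a::f_algebra"
  assumes unit: "\<And>x. u * x = x" "\<And>x. x * u = x"
begin

lemma unit_nonneg: "0 \<le> u"
  using f_algebra_square_nonneg[of u] unit by simp

lemma disjoint_unit_eq_0:
  assumes "inf t u = 0"
  shows "t = 0"
  using disjoint_mult_eq_0[OF assms] unit by simp

lemma disjoint_scaleR:
  fixes c :: real and x y :: 'a
  assumes "0 \<le> c" "inf x y = 0"
  shows "inf (c *\<^sub>R x) y = 0"
proof -
  have "0 \<le> c *\<^sub>R u" using assms unit_nonneg by (simp add: scaleR_nonneg_nonneg)
  with assms(2) have "inf ((c *\<^sub>R u) * x) y = 0" by (rule f_algebra_left)
  then show ?thesis by (simp add: unit)
qed

text \<open>The supports \<open>{y > a}\<close> and \<open>{y < b}\<close> cover everything if \<open>a < b\<close>.\<close>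

lemma disjoint_upper_lower_eq_0:
  fixes a b :: real
  assumes t: "0 \<le> t" and ab: "a < b"
    and up: "inf t (pprt (y - a *\<^sub>R u)) = 0" and low: "inf t (pprt (b *\<^sub>R u - y)) = 0"
  shows "t = 0"
proof -
  have "(b - a) *\<^sub>R u = (y - a *\<^sub>R u) + (b *\<^sub>R u - y)" by (simp add: algebra_simps)
  also have "\<dots> \<le> pprt (y - a *\<^sub>R u) + pprt (b *\<^sub>R u - y)"
    by (intro add_mono) (simp_all add: pprt_def)
  finally have "inf t ((b - a) *\<^sub>R u) \<le> inf t (pprt (y - a *\<^sub>R u) + pprt (b *\<^sub>R u - y))"
    by (intro inf_mono) simp_all
  also have "\<dots> \<le> 0"
    using inf_add_le[OF t zero_le_pprt zero_le_pprt, of "y - a *\<^sub>R u" "b *\<^sub>R u - y"] up low by simp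
  finally have disj: "inf ((b - a) *\<^sub>R u) t = 0"
    using t ab unit_nonneg by (intro antisym) (simp_all add: inf_commute scaleR_nonneg_nonneg)
  have "0 \<le> 1 / (b - a)" using ab by simp
  from disjoint_scaleR[OF this disj] have "inf ((1 / (b - a)) *\<^sub>R (b - a) *\<^sub>R u) t = 0" .
  moreover have "(1 / (b - a)) *\<^sub>R (b - a) *\<^sub>R u = u" using ab by simp
  ultimately have "inf t u = 0" by (simp only: inf_commute[of t])
  then show ?thesis by (rule disjoint_unit_eq_0)
qed

text \<open>
  If the support of \<open>r\<close> misses every strip \<open>{c - \<epsilon> < y < c + \<epsilon>}\<close>, it misses every strip
  \<open>{a < y < b}\<close>, however wide: consecutive short strips overlap, so a finite chain of
  them covers the wide one.
\<close>

lemma disjoint_strips_widen: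
  fixes a b \<epsilon> :: real
  assumes r: "0 \<le> r" and eps: "0 < \<epsilon>"
    and strip: "\<And>c. inf r (inf (pprt (y - (c - \<epsilon>) *\<^sub>R u)) (pprt ((c + \<epsilon>) *\<^sub>R u - y))) = 0"
  shows "inf r (inf (pprt (y - a *\<^sub>R u)) (pprt (b *\<^sub>R u - y))) = 0"
proof -
  have grid: "inf r (inf (pprt (y - a *\<^sub>R u)) (pprt ((a + real n * \<epsilon>) *\<^sub>R u - y))) = 0" for n
  proof (induction n)
    case 0
    show ?case using inf_pprt_uminus[of "y - a *\<^sub>R u"] r by (simp add: inf_absorb2)
  next
    case (Suc n)
    define c where "c = a + real n * \<epsilon>"
    let ?A = "pprt (y - a *\<^sub>R u)" and ?B = "pprt ((c + \<epsilon>) *\<^sub>R u - y)"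
    define t where "t = inf r (inf ?A ?B)"
    have t0: "0 \<le> t" unfolding t_def using r by simp
    have "inf t (pprt (y - (c - \<epsilon>) *\<^sub>R u)) = 0"
    proof (rule antisym)
      show "inf t (pprt (y - (c - \<epsilon>) *\<^sub>R u)) \<le> 0"
        unfolding t_def strip[of c, symmetric] by (auto intro: le_infI1 le_infI2)
    qed (use t0 in simp)
    moreover have "inf t (pprt (c *\<^sub>R u - y)) = 0"
    proof (rule antisym)
      show "inf t (pprt (c *\<^sub>R u - y)) \<le> 0"
        unfolding t_def Suc.IH[symmetric] c_def by (auto intro: le_infI1 le_infI2)
    qed (use t0 in simp)
    ultimately have "t = 0"
      using disjoint_upper_lower_eq_0[OF t0, of "c - \<epsilon>" c] eps by simp
    moreover have "c + \<epsilon> = a + real (Suc n) * \<epsilon>" by (simp add: c_def algebra_simps)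
    ultimately show ?case by (simp add: t_def)
  qed
  obtain n :: nat where "(b - a) / \<epsilon> \<le> real n" using real_arch_simple by blast
  then have "b \<le> a + real n * \<epsilon>" using eps by (simp add: field_simps)
  then have "pprt (b *\<^sub>R u - y) \<le> pprt ((a + real n * \<epsilon>) *\<^sub>R u - y)"
    using unit_nonneg by (intro pprt_mono diff_right_mono scaleR_right_mono)
  then have "inf r (inf (pprt (y - a *\<^sub>R u)) (pprt (b *\<^sub>R u - y))) \<le> 0"
    unfolding grid[of n, symmetric] by (intro inf_mono) simp_all
  then show ?thesis using r by (intro antisym) simp_all
qed

end

text \<open>Each \<open>b n\<close> vanishes on the support of \<open>t\<close>, so \<open>k\<close> is at least \<open>n\<close> there for every \<open>n\<close>.
  By the Archimedean property this support is empty.\<close>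

lemma disjoint_exhaustion_eq_0:
  fixes u t k :: "'u::{universally_complete_riesz_space, f_algebra}"
  assumes unit: "\<And>x. u * x = x" "\<And>x. x * u = x"
    and t: "0 \<le> t" and k: "0 \<le> k"
    and b: "\<And>n::nat. 0 \<le> b n" "\<And>n. inf t (b n) = 0" "\<And>n. real n *\<^sub>R u \<le> b n + k"
  shows "t = 0"
proof -
  have "real n *\<^sub>R inf t u \<le> k" for n
  proof -
    have nt: "0 \<le> real n *\<^sub>R t" using t by (simp add: scaleR_nonneg_nonneg)
    have "real n *\<^sub>R inf t u \<le> inf (real n *\<^sub>R t) (real n *\<^sub>R u)"
      by (simp add: scaleR_left_mono)
    also have "\<dots> \<le> inf (real n *\<^sub>R t) (b n + k)" using b(3) by (intro inf_mono) simp_all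
    also have "\<dots> \<le> inf (real n *\<^sub>R t) (b n) + inf (real n *\<^sub>R t) k"
      using nt b(1) k by (rule inf_add_le)
    also have "inf (real n *\<^sub>R t) (b n) = 0"
      using disjoint_scaleR[OF unit _ b(2)] by simp
    finally show ?thesis by simp
  qed
  then have "inf t u \<le> 0" by (rule archimedean_riesz)
  then have "inf t u = 0" using t unit_nonneg[OF unit] by (intro antisym) simp_all
  then show ?thesis by (rule disjoint_unit_eq_0[OF unit])
qed

text \<open>As the ends \<open>a\<close> and \<open>b\<close> of the missed strip tend to infinity, the strip exhausts
  everything. The ends are moved one at a time: first \<open>b = n\<close>, which leaves the supports
  \<open>{y > a}\<close>, and then \<open>a = - n\<close>. The bound \<open>k\<close> of the preceding lemma is \<open>\<bar>y\<bar>\<close> both times.\<close>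

lemma disjoint_strips_eq_0:
  fixes u r y :: "'u::{universally_complete_riesz_space, f_algebra}" and \<epsilon> :: real
  assumes unit: "\<And>x. u * x = x" "\<And>x. x * u = x"
    and r: "0 \<le> r" and eps: "0 < \<epsilon>"
    and strip: "\<And>c. inf r (inf (pprt (y - (c - \<epsilon>) *\<^sub>R u)) (pprt ((c + \<epsilon>) *\<^sub>R u - y))) = 0"
  shows "r = 0"
proof -
  note wide = disjoint_strips_widen[OF unit r eps strip]
  have below: "x \<le> pprt (x + z) + \<bar>z\<bar>" for x z :: 'u
  proof -
    have "x = (x + z) + (- z)" by simp
    also have "\<dots> \<le> pprt (x + z) + \<bar>z\<bar>" by (intro add_mono) (simp_all add: pprt_def abs_ge_minus_self)
    finally show ?thesis .
  qed
  have "inf r (pprt (y - a *\<^sub>R u)) = 0" for a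
  proof (rule disjoint_exhaustion_eq_0[OF unit])
    show "inf (inf r (pprt (y - a *\<^sub>R u))) (pprt (real n *\<^sub>R u - y)) = 0" for n
      using wide[of a "real n"] by (simp add: inf_assoc)
    show "real n *\<^sub>R u \<le> pprt (real n *\<^sub>R u - y) + \<bar>y\<bar>" for n
      using below[of "real n *\<^sub>R u" "- y"] by simp
  qed (use r in simp_all)
  then have upper: "inf r (pprt (y - (- real n) *\<^sub>R u)) = 0" for n .
  show ?thesis
  proof (rule disjoint_exhaustion_eq_0[OF unit r _ _ upper])
    show "real n *\<^sub>R u \<le> pprt (y - (- real n) *\<^sub>R u) + \<bar>y\<bar>" for n
      using below[of "real n *\<^sub>R u" y] by (simp add: add.commute)
  qed simp_all
qed

text \<open>
  The infimum over \<open>c\<close> of \<open>(y - c u)\<^sup>2\<close> is zero. Factoring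
  \<open>(y - c u)\<^sup>2 - \<epsilon>\<^sup>2 u = (\<bar>y - c u\<bar> - \<epsilon> u) (\<bar>y - c u\<bar> + \<epsilon> u)\<close> shows that the part of a lower
  bound \<open>v\<close> exceeding \<open>\<epsilon>\<^sup>2 u\<close> is supported where \<open>\<bar>y - c u\<bar> > \<epsilon> u\<close>. This holds for all \<open>c\<close>, so
  that part is zero.
\<close>

lemma lower_bound_of_squares_nonpos:
  fixes u v y :: "'u::{universally_complete_riesz_space, f_algebra}"
  assumes unit: "\<And>x. u * x = x" "\<And>x. x * u = x"
    and v: "\<And>c::real. v \<le> (y - c *\<^sub>R u) * (y - c *\<^sub>R u)"
  shows "v \<le> 0"
proof -
  note u0 = unit_nonneg[OF unit]
  have small: "v \<le> (\<epsilon> * \<epsilon>) *\<^sub>R u" if eps: "0 < \<epsilon>" for \<epsilon> :: real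
  proof -
    define r where "r = pprt (v - (\<epsilon> * \<epsilon>) *\<^sub>R u)"
    have "r = 0"
    proof (rule disjoint_strips_eq_0[OF unit _ eps])
      show "0 \<le> r" by (simp add: r_def)
      fix c :: real
      define d where "d = \<bar>y - c *\<^sub>R u\<bar>"
      have eu: "0 \<le> \<epsilon> *\<^sub>R u" using eps u0 by (simp add: scaleR_nonneg_nonneg)
      have du: "0 \<le> d + \<epsilon> *\<^sub>R u" using eu by (simp add: d_def)
      have "v - (\<epsilon> * \<epsilon>) *\<^sub>R u \<le> d * d - (\<epsilon> * \<epsilon>) *\<^sub>R u"
        using v[of c] by (simp add: d_def abs_mult_abs_self)
      also have "\<dots> = (d - \<epsilon> *\<^sub>R u) * (d + \<epsilon> *\<^sub>R u)"
        by (simp add: algebra_simps unit)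
      also have "\<dots> \<le> pprt (d - \<epsilon> *\<^sub>R u) * (d + \<epsilon> *\<^sub>R u)"
        using du by (intro mult_right_mono) (simp_all add: pprt_def)
      finally have le: "r \<le> pprt (d - \<epsilon> *\<^sub>R u) * (d + \<epsilon> *\<^sub>R u)"
        unfolding r_def using du by (simp add: pprt_def[of "v - _"])
      have "inf (pprt (d - \<epsilon> *\<^sub>R u)) (pprt (- (d - \<epsilon> *\<^sub>R u))) = 0" by (rule inf_pprt_uminus)
      then have "inf (pprt (d - \<epsilon> *\<^sub>R u) * (d + \<epsilon> *\<^sub>R u)) (pprt (- (d - \<epsilon> *\<^sub>R u))) = 0"
        using du by (rule f_algebra_right)
      then have disj: "inf r (pprt (\<epsilon> *\<^sub>R u - d)) = 0"
        by (rule inf_eq_0_mono[OF _ _ le]) (simp_all add: r_def)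
      \<comment> \<open>In terms of supports, this is the identity
        \<open>{\<bar>y - c\<bar> < \<epsilon>} = {c - \<epsilon> < y} \<inter> {y < c + \<epsilon>}\<close>.\<close>
      have "inf (pprt (y - (c - \<epsilon>) *\<^sub>R u)) (pprt ((c + \<epsilon>) *\<^sub>R u - y)) = pprt (\<epsilon> *\<^sub>R u - d)"
      proof -
        have "inf (\<epsilon> *\<^sub>R u + (y - c *\<^sub>R u)) (\<epsilon> *\<^sub>R u - (y - c *\<^sub>R u)) = \<epsilon> *\<^sub>R u - d"
          unfolding d_def abs_lattice diff_conv_add_uminus minus_add_distrib neg_sup_eq_inf
          by (simp add: add_inf_distrib_left inf_commute)
        moreover have "y - (c - \<epsilon>) *\<^sub>R u = \<epsilon> *\<^sub>R u + (y - c *\<^sub>R u)"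
          "(c + \<epsilon>) *\<^sub>R u - y = \<epsilon> *\<^sub>R u - (y - c *\<^sub>R u)"
          by (simp_all add: algebra_simps)
        ultimately show ?thesis by (simp only: flip: pprt_inf)
      qed
      with disj show "inf r (inf (pprt (y - (c - \<epsilon>) *\<^sub>R u)) (pprt ((c + \<epsilon>) *\<^sub>R u - y))) = 0"
        by simp
    qed
    then show ?thesis by (simp add: r_def flip: le_zero_iff_pprt_id le_zero_iff_zero_pprt)
  qed
  \<comment> \<open>The choice \<open>\<epsilon> = 1 / sqrt n\<close> brings the bound into Archimedean form.\<close>
  have "real n *\<^sub>R v \<le> u" for n
  proof (cases "n = 0")
    case False
    have "real n *\<^sub>R v \<le> real n *\<^sub>R (sqrt (1 / real n) * sqrt (1 / real n)) *\<^sub>R u"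
      using False by (intro scaleR_left_mono small) simp_all
    then show ?thesis using False by simp
  qed (use u0 in simp)
  then show ?thesis by (rule archimedean_riesz)
qed

section \<open>Conditional expectations preserve square integrability\<close>

theorem theorem3p2:
  fixes T S :: "'a::dedekind_complete_riesz_space \<Rightarrow> 'a"
    and J :: "'a \<Rightarrow> 'u::{universally_complete_riesz_space, f_algebra}"
    and e f :: 'a
  assumes "universal_completion J"
    and "weak_order_unit e"
    and "natural_multiplication (J e)"
    and "conditional_expectation T"
    and "strictly_positive T"
    and "T e = e"
    and "T_universally_complete J T"
    and "conditional_expectation S"
    and "\<And>x. T (S x) = T x"
    and "\<And>x. S (T x) = T x"
    and "f \<in> L2_space J"
  shows "S f \<in> L2_space J"
proof -
  have J: "linear J" using assms(1) by (simp add: universal_completion_def)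
  have S: "linear S" and S_nonneg: "\<And>x. 0 \<le> x \<Longrightarrow> 0 \<le> S x"
    using assms(8) by (auto simp: conditional_expectation_def)
  have Se: "S e = e" using assms(6) assms(10)[of e] by simp
  have unit: "J e * x = x" "x * J e = x" for x
    using assms(3) by (auto simp: natural_multiplication_def)
  note J_simps = linear_diff[OF J] linear_cmul[OF J]
  have square: "(J x - c *\<^sub>R J e) * (J x - c *\<^sub>R J e)
      = J x * J x - J ((2 * c) *\<^sub>R x - (c * c) *\<^sub>R e)" for x and c :: real
    by (simp add: J_simps algebra_simps unit) (simp add: scaleR_2 scaleR_right_distrib flip: scaleR_scaleR)
  obtain g where g: "J f * J f = J g" using assms(11) by (auto simp: L2_space_def)
  have "J (S f) * J (S f) - J (S g) \<le> (J (S f) - c *\<^sub>R J e) * (J (S f) - c *\<^sub>R J e)" for c :: real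
  proof -
    have "J ((2 * c) *\<^sub>R f - (c * c) *\<^sub>R e) \<le> J g"
      using f_algebra_square_nonneg[of "J f - c *\<^sub>R J e"] square[of f c] g by simp
    then have "0 \<le> g - ((2 * c) *\<^sub>R f - (c * c) *\<^sub>R e)"
      using universal_completion_le_iff[OF assms(1)] by (simp del: diff_ge_0_iff_ge add: le_diff_eq)
    from S_nonneg[OF this] have "(2 * c) *\<^sub>R S f - (c * c) *\<^sub>R e \<le> S g"
      by (simp add: linear_diff[OF S] linear_cmul[OF S] Se)
    then have "J ((2 * c) *\<^sub>R S f - (c * c) *\<^sub>R e) \<le> J (S g)"
      using universal_completion_le_iff[OF assms(1)] by simp
    then show ?thesis unfolding square by simp
  qed
  from lower_bound_of_squares_nonpos[OF unit this]
  have "J (S f) * J (S f) \<le> J (S g)" by simp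
  with universal_completion_ideal[OF assms(1) f_algebra_square_nonneg]
  show ?thesis by (simp add: L2_space_def)
qed

end
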